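(* There is an isomorphism of groups $$\mathrm{Aut}(\mathcal{A},\,-\,)\;\cong\;\big((S^1\times S^1)\rtimes C_2\big)\rtimes S_3 .$$
   Context: $\mathbb{F}$ is an algebraically closed field of characteristic different from $2,3,5$. Let $\mathcal{B}=\mathbb{F}\oplus\mathbb{F}\oplus\mathbb{F}\oplus\mathbb{F}$ with componentwise product, $t$ its trace (sum of the four coordinates), and $b^\theta=-b+\tfrac12 t(b)1$ for $b\in\mathcal{B}$. The split quartic Cayley algebra is the (nonassociative, unital) algebra with involution $\mathcal{A}=\mathcal{B}\oplus s\mathcal{B}=\{b_1+sb_2\mid b_1,b_2\in\mathcal{B}\}$, with product and involution $$(b_1+sb_2)(b_3+sb_4)=\big(b_1b_3+(b_2b_4^\theta)^\theta\big)+s\big(b_1^\theta b_4+(b_2^\theta b_3^\theta)^\theta\big),\qquad \overline{b_1+sb_2}=b_1-sb_2^\theta .$$ Write $s=s1$. $\mathrm{Aut}(\mathcal{A},-)$ is the group of $\mathbb{F}$-algebra automorphisms of $\mathcal{A}$ commuting with the involution. $\mathcal{K}=\mathbb{F}1\oplus\mathbb{F}s$ is a subalgebra of $\mathcal{A}$, with $s^2=1$ and $\overline{\alpha1+\beta s}=\alpha1-\beta s$. $S^1=\{r\in\mathcal{K}^\times\mid r\overline r=1\}$, a subgroup of $\mathcal{K}^\times$. $C_2$ is the cyclic group of order $2$, whose generator acts on $\mathcal{K}$ by the algebra automorphism $s\mapsto -s$. The group $(S^1\times S^1)\rtimes C_2$ has product $(r_1,r_2,g)\star(s_1,s_2,h)=(r_1g(s_1),r_2g(s_2),gh)$.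 $S_3$ is the symmetric group on $\{1,2,3\}$, acting on $(S^1\times S^1)\rtimes C_2$ by $\tau\cdot(r_1,r_2,g)=(r_{\tau^{-1}(1)},r_{\tau^{-1}(2)},g)$, where $r_3:=\overline{r_1r_2}$. *)

theory Defs
  imports
    "HOL-Analysis.Finite_Cartesian_Product"
    "HOL-Computational_Algebra.Polynomial"
    "HOL-Algebra.Sym_Groups"
    "HOL-Algebra.Elementary_Groups"
begin

section \<open>The split quartic Cayley algebra\<close>

text \<open>
  The algebra \<open>B\<close> is \<open>'a ^ 4\<close>, whose library multiplication is componentwise.
  The pair \<open>(b1, b2)\<close> stands for \<open>b1 + s b2\<close>; addition is the library's addition of pairs.
\<close>

type_synonym 'a quartic_cayley = "('a ^ 4) \<times> ('a ^ 4)"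

definition qtrace :: "'a::field ^ 4 \<Rightarrow> 'a" where
  "qtrace b = (\<Sum>i\<in>UNIV. b $ i)"

definition theta :: "'a::field ^ 4 \<Rightarrow> 'a ^ 4" where
  "theta b = - b + (qtrace b / 2) *s 1"

definition qc_scale :: "'a::field \<Rightarrow> 'a quartic_cayley \<Rightarrow> 'a quartic_cayley" where
  "qc_scale c x = (c *s fst x, c *s snd x)"

fun qc_mult :: "'a::field quartic_cayley \<Rightarrow> 'a quartic_cayley \<Rightarrow> 'a quartic_cayley" where
  "qc_mult (b1, b2) (b3, b4) =
     (b1 * b3 + theta (b2 * theta b4), theta b1 * b4 + theta (theta b2 * theta b3))"

definition qc_one :: "'a::field quartic_cayley" where
  "qc_one = (1, 0)"

definition qc_s :: "'a::field quartic_cayley" where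
  "qc_s = (0, 1)"

fun qc_bar :: "'a::field quartic_cayley \<Rightarrow> 'a quartic_cayley" where
  "qc_bar (b1, b2) = (b1, - theta b2)"

text \<open>
  \<open>f qc_one = qc_one\<close> need not be demanded: it follows from surjectivity and multiplicativity.
\<close>

definition Aut_quartic_cayley :: "('a::field quartic_cayley \<Rightarrow> 'a quartic_cayley) monoid" where
  "Aut_quartic_cayley =
     \<lparr> carrier = {f. bij f \<and> Vector_Spaces.linear qc_scale qc_scale f \<and>
                     (\<forall>x y. f (qc_mult x y) = qc_mult (f x) (f y)) \<and>
                     (\<forall>x. f (qc_bar x) = qc_bar (f x))},
       mult = (\<circ>), one = id \<rparr>"


section \<open>The groups on the right-hand side\<close>

definition K_monoid :: "'a::field quartic_cayley monoid" where
  "K_monoid = \<lparr> carrier = {qc_scale \<alpha> qc_one + qc_scale \<beta> qc_s |\<alpha> \<beta>. True},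
                mult = qc_mult, one = qc_one \<rparr>"

definition S1 :: "'a::field quartic_cayley monoid" where
  "S1 = (units_of K_monoid) \<lparr> carrier := {r \<in> Units K_monoid. qc_mult r (qc_bar r) = qc_one} \<rparr>"

text \<open>
  On \<open>K\<close> the following map is the algebra automorphism with \<open>s \<mapsto> - s\<close>
  (see \<open>K_aut_K\<close>); values outside \<open>K\<close> are irrelevant.
\<close>

definition K_aut :: "'a::field quartic_cayley \<Rightarrow> 'a quartic_cayley" where
  "K_aut x = (fst x, - snd x)"

text \<open>The cyclic group of order 2 is \<open>integer_mod_group 2\<close>, with carrier \<open>{0, 1}\<close>.\<close>

definition C2_act :: "int \<Rightarrow> 'a::field quartic_cayley \<Rightarrow> 'a quartic_cayley" where
  "C2_act g = (if g = 0 then id else K_aut)"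

definition semidirect_product ::
    "('a, 'm) monoid_scheme \<Rightarrow> ('b, 'n) monoid_scheme \<Rightarrow> ('b \<Rightarrow> 'a \<Rightarrow> 'a) \<Rightarrow> ('a \<times> 'b) monoid" where
  "semidirect_product N H \<phi> =
     \<lparr> carrier = carrier N \<times> carrier H,
       mult = (\<lambda>(n, h) (n', h'). (n \<otimes>\<^bsub>N\<^esub> \<phi> h n', h \<otimes>\<^bsub>H\<^esub> h')),
       one = (\<one>\<^bsub>N\<^esub>, \<one>\<^bsub>H\<^esub>) \<rparr>"

definition S1S1_C2 ::
    "(('a::field quartic_cayley \<times> 'a quartic_cayley) \<times> int) monoid" where
  "S1S1_C2 = semidirect_product (S1 \<times>\<times> S1) (integer_mod_group 2) (\<lambda>g. map_prod (C2_act g) (C2_act g))"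

text \<open>The entry \<open>r i\<close> of the triple \<open>(r1, r2, r3)\<close> with \<open>r3\<close> the conjugate of \<open>r1 r2\<close>.\<close>

definition triple_entry ::
    "'a::field quartic_cayley \<Rightarrow> 'a quartic_cayley \<Rightarrow> nat \<Rightarrow> 'a quartic_cayley" where
  "triple_entry r1 r2 i = (if i = 1 then r1 else if i = 2 then r2 else qc_bar (qc_mult r1 r2))"

fun S3_act :: "(nat \<Rightarrow> nat) \<Rightarrow> ('a::field quartic_cayley \<times> 'a quartic_cayley) \<times> int \<Rightarrow>
    ('a quartic_cayley \<times> 'a quartic_cayley) \<times> int" where
  "S3_act \<tau> ((r1, r2), g) =
     ((triple_entry r1 r2 (inv' \<tau> 1), triple_entry r1 r2 (inv' \<tau> 2)), g)"

definition S1S1_C2_S3 ::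
    "((('a::field quartic_cayley \<times> 'a quartic_cayley) \<times> int) \<times> (nat \<Rightarrow> nat)) monoid" where
  "S1S1_C2_S3 = semidirect_product S1S1_C2 (sym_group 3) S3_act"


section \<open>Basic facts\<close>

lemma theta_zero [simp]: "theta 0 = 0"
  by (simp add: theta_def qtrace_def vec_eq_iff)

lemma theta_one:
  assumes "(2::'a::field) \<noteq> 0"
  shows "theta (1 :: 'a ^ 4) = 1"
proof -
  have "(4::'a) / 2 = 2"
    using assms by (simp add: field_simps)
  then show ?thesis
    by (simp add: theta_def qtrace_def vec_eq_iff)
qed

lemma theta_scale: "theta (c *s b) = c *s theta b"
  by (simp add: theta_def qtrace_def vec_eq_iff sum_distrib_left [symmetric] algebra_simps)

lemma vector_space_qc_scale: "vector_space qc_scale"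
  by unfold_locales (simp_all add: qc_scale_def vector_add_ldistrib vector_sadd_rdistrib vector_smult_assoc)

lemma qc_s_square:
  assumes "(2::'a::field) \<noteq> 0"
  shows "qc_mult qc_s qc_s = (qc_one :: 'a quartic_cayley)"
  using assms by (simp add: qc_s_def qc_one_def theta_one)

lemma qc_bar_K:
  assumes "(2::'a::field) \<noteq> 0"
  shows "qc_bar (qc_scale \<alpha> qc_one + qc_scale \<beta> qc_s) =
         qc_scale \<alpha> qc_one - qc_scale (\<beta>::'a) qc_s"
  using assms by (simp add: qc_s_def qc_one_def qc_scale_def theta_scale theta_one)

lemma K_aut_K:
  "K_aut (qc_scale \<alpha> qc_one + qc_scale \<beta> qc_s) = qc_scale \<alpha> qc_one - qc_scale \<beta> qc_s"
  by (simp add: K_aut_def qc_s_def qc_one_def qc_scale_def)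

end

theory Submission
  imports Defs "HOL-Analysis.Cartesian_Space"
begin

text \<open>
  The characters \<open>a\<^sub>0 = 1, a\<^sub>1, a\<^sub>2, a\<^sub>3\<close> of Klein's four-group form a basis of \<open>B\<close>. They
  diagonalize \<open>theta\<close>, with eigenvalue \<open>1\<close> on \<open>a\<^sub>0\<close> and \<open>-1\<close> on the others, and multiply like the
  four-group itself. So the algebra is \<open>K a\<^sub>0 \<oplus> K a\<^sub>1 \<oplus> K a\<^sub>2 \<oplus> K a\<^sub>3\<close>. The idempotents \<open>(1 \<plusminus> s)/2\<close>
  of \<open>K\<close> split each \<open>K a\<^sub>i\<close> into two lines. In the resulting coordinates \<open>p, q\<close> (on \<open>K\<close>) and
  \<open>x, y\<close> (two vectors of length three, on the other summands) the algebra looks like Zorn's vector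
  matrices, except that the cross product is the symmetric one,
  \<open>(x \<times> x')\<^sub>i = x\<^sub>j x'\<^sub>k + x\<^sub>k x'\<^sub>j\<close>:
  \<open>(p, q, x, y) (p', q', x', y')
      = (p p' + x \<bullet> y', q q' + y \<bullet> x', p x' + q' x + y \<times> y', q y' + p' y + x \<times> x')\<close>,
  and the involution exchanges \<open>p\<close> and \<open>q\<close> (\<open>coord_mult_0\<close>, \<open>coord_mult\<close>, \<open>coord_bar\<close>).

  Permuting the three indices, exchanging \<open>(p, x)\<close> with \<open>(q, y)\<close>, and scaling
  \<open>x\<^sub>i \<mapsto> \<lambda>\<^sub>i x\<^sub>i\<close>, \<open>y\<^sub>i \<mapsto> \<lambda>\<^sub>i\<inverse> y\<^sub>i\<close> with \<open>\<lambda>\<^sub>1 \<lambda>\<^sub>2 \<lambda>\<^sub>3 = 1\<close> are visibly automorphisms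
  (\<open>monomial_map_Aut\<close>).

  Conversely, let \<open>f\<close> be an automorphism. The image \<open>e\<close> of \<open>(1 + s)/2\<close> is an idempotent with
  \<open>e + e\<^sup>- = 1\<close>, where \<open>e\<^sup>-\<close> is its conjugate, and only \<open>(1 \<plusminus> s)/2\<close> have these properties. Hence \<open>f\<close>
  either preserves or exchanges the two idempotents, and with them the space of the \<open>x\<close> and the
  space of the \<open>y\<close>. A basis vector of one of these spaces has square zero. Since \<open>x \<times> x\<close> has the
  entries \<open>2 x\<^sub>j x\<^sub>k\<close>, a vector of square zero has at most one nonzero coordinate. So \<open>f\<close> is a
  monomial map; the pairing \<open>x \<bullet> y\<close> forces the same permutation and inverse factors on the two
  spaces, and the cross product of two basis vectors forces the product of the factors to be one
  (\<open>automorphism_is_monomial\<close>).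

  Finally \<open>\<alpha> + \<beta> s\<close> has the coordinates \<open>\<alpha> + \<beta>\<close> and \<open>\<alpha> - \<beta>\<close>, so an element of \<open>S1\<close> is a pair
  \<open>(\<lambda>, \<lambda>\<inverse>)\<close>, and the factors of a monomial automorphism are a triple in \<open>S1\<close> with product one.
  Sending \<open>(r\<^sub>1, r\<^sub>2, g, \<tau>)\<close> to the automorphism \<open>k a\<^sub>i \<mapsto> r\<^sub>\<tau>\<^sub>(\<^sub>i\<^sub>) g(k) a\<^sub>\<tau>\<^sub>(\<^sub>i\<^sub>)\<close> is the desired
  isomorphism (\<open>monomial_of_hom\<close>, \<open>monomial_of_bij_betw\<close>).
\<close>

section \<open>The index set of the three Peirce components\<close>

lemma le_3_cases:
  assumes "i \<le> (3::nat)" obtains "i = 0" | "i = 1" | "i = 2" | "i = 3"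
  using assms by linarith

lemma mem_1_3_iff: "i \<in> {1..3} \<longleftrightarrow> i = 1 \<or> i = 2 \<or> i = (3::nat)"
  by auto

lemma sum_1_3: "sum f {1..3::nat} = f 1 + (f 2 + f 3)"
proof -
  have "{1..3} = {1, 2, 3::nat}" by auto
  then show ?thesis by simp
qed

text \<open>
  With \<open>l\<close> fixed, the only pairs \<open>(j, k)\<close> that contribute are \<open>(m, n)\<close> and \<open>(n, m)\<close>. The double sum on
  the left is entry \<open>l\<close> of the symmetric cross product; in that form it can be reindexed by a
  permutation without a case distinction.
\<close>

lemma sum_distinct_1_3:
  fixes a b :: "nat \<Rightarrow> 'a::comm_ring"
  assumes "l \<in> {1..3}" "m \<in> {1..3}" "n \<in> {1..3}" "distinct [l, m, n]"
  shows "(\<Sum>j\<in>{1..3}. \<Sum>k\<in>{1..3}. if distinct [l, j, k] then a j * b k else 0) = a m * b n + a n * b m"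
  using assms unfolding mem_1_3_iff sum_1_3
  by (elim disjE) (simp_all add: add.commute del: One_nat_def)

lemma permutes_1_3:
  assumes "\<tau> permutes {1..3::nat}"
  shows "\<tau> 0 = 0" and "i \<in> {1..3} \<Longrightarrow> \<tau> i \<in> {1..3}" and "i \<le> 3 \<Longrightarrow> \<tau> i \<le> 3" and "\<tau> i = 0 \<longleftrightarrow> i = 0"
proof -
  show 0: "\<tau> 0 = 0"
    using permutes_not_in[OF assms, of 0] by simp
  show in3: "\<tau> i \<in> {1..3}" if "i \<in> {1..3}" for i
    using that by (simp only: permutes_in_image[OF assms])
  show "\<tau> i \<le> 3" if "i \<le> 3"
    using 0 in3[of i] that by (cases "i = 0") auto
  show "\<tau> i = 0 \<longleftrightarrow> i = 0"
    using 0 permutes_inj[OF assms] by (metis inj_eq)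
qed

section \<open>Peirce coordinates\<close>

text \<open>
  The coefficient of \<open>b\<close> at the character \<open>a\<^sub>i\<close>, where \<open>a\<^sub>0 = 1\<close> and, for \<open>i > 0\<close>, \<open>a\<^sub>i\<close> has the entry
  \<open>1\<close> at the positions \<open>i\<close> and \<open>4\<close> and \<open>-1\<close> elsewhere.
\<close>

definition klein_coeff :: "nat \<Rightarrow> 'a::field ^ 4 \<Rightarrow> 'a" where
  "klein_coeff i b =
     (let sg = (\<lambda>j. if i = 0 \<or> i = j then 1 else - 1)
      in (b $ 4 + sg 1 * b $ 1 + sg 2 * b $ 2 + sg 3 * b $ 3) / 4)"

definition of_klein_coeffs :: "(nat \<Rightarrow> 'a::field) \<Rightarrow> 'a ^ 4" where
  "of_klein_coeffs c = (\<chi> j. if j = 1 then c 0 + c 1 - c 2 - c 3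
                         else if j = 2 then c 0 - c 1 + c 2 - c 3
                         else if j = 3 then c 0 - c 1 - c 2 + c 3
                         else c 0 + c 1 + c 2 + c 3)"

text \<open>
  The coordinate with respect to \<open>(a\<^sub>i + s a\<^sub>i)/2\<close> if \<open>\<epsilon>\<close> is true and \<open>(a\<^sub>i - s a\<^sub>i)/2\<close> otherwise. Signs are
  booleans so that \<open>\<not> \<epsilon>\<close> is the opposite sign and \<open>\<epsilon> \<noteq> g\<close> is the sign \<open>\<epsilon>\<close>, flipped if \<open>g\<close> holds.
\<close>

definition coord :: "bool \<Rightarrow> nat \<Rightarrow> 'a::field quartic_cayley \<Rightarrow> 'a" where
  "coord \<epsilon> i v = klein_coeff i (fst v) + (if \<epsilon> then 1 else - 1) * klein_coeff i (snd v)"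

definition of_coords :: "(bool \<Rightarrow> nat \<Rightarrow> 'a::field) \<Rightarrow> 'a quartic_cayley" where
  "of_coords c = (of_klein_coeffs (\<lambda>i. (c True i + c False i) / 2),
                  of_klein_coeffs (\<lambda>i. (c True i - c False i) / 2))"

context
  assumes two: "(2::'a::field) \<noteq> 0"
begin

lemma four_neq_zero: "(4::'a) \<noteq> 0"
proof -
  have "(4::'a) = 2 * 2" by simp
  then show ?thesis using two by (metis mult_eq_0_iff)
qed

lemma klein_coeff_of_klein_coeffs:
  assumes "i \<le> 3"
  shows "klein_coeff i (of_klein_coeffs c) = (c i :: 'a)"
  using assms four_neq_zero
  by (cases rule: le_3_cases) (simp_all add: klein_coeff_def of_klein_coeffs_def field_simps)

lemma of_klein_coeffs_klein_coeff: "of_klein_coeffs (\<lambda>i. klein_coeff i b) = (b :: 'a ^ 4)"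
proof -
  have "x / 4 = 1 / 4 * x" "4 * (1 / 4) = (1 :: 'a)" for x :: 'a
    using four_neq_zero by simp_all
  then obtain h :: 'a where h: "\<And>x :: 'a. x / 4 = h * x" "4 * h = 1"
    by blast
  show ?thesis
    unfolding vec_eq_iff forall_4
    by (intro conjI; simp add: of_klein_coeffs_def klein_coeff_def h(1); use h(2) in algebra)
qed

lemma klein_coeff_ext:
  assumes "\<And>i. i \<le> 3 \<Longrightarrow> klein_coeff i b = (klein_coeff i c :: 'a)"
  shows "b = c"
proof -
  have "of_klein_coeffs (\<lambda>i. klein_coeff i b) = of_klein_coeffs (\<lambda>i. klein_coeff i c :: 'a)"
    by (simp add: of_klein_coeffs_def assms cong: if_cong)
  then show ?thesis
    by (simp add: of_klein_coeffs_klein_coeff)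
qed

lemma klein_coeff_linear [simp]:
  "klein_coeff i (b + c) = klein_coeff i b + (klein_coeff i c :: 'a)"
  "klein_coeff i (b - c) = klein_coeff i b - (klein_coeff i c :: 'a)"
  "klein_coeff i (- b) = - (klein_coeff i b :: 'a)"
  "klein_coeff i (r *s b) = r * (klein_coeff i b :: 'a)"
  "klein_coeff i 0 = (0 :: 'a)"
  by (auto simp: klein_coeff_def Let_def add_divide_distrib diff_divide_distrib algebra_simps)

lemma klein_coeff_one [simp]: "i \<le> 3 \<Longrightarrow> klein_coeff i 1 = (if i = 0 then 1 else 0 :: 'a)"
  using four_neq_zero by (elim le_3_cases) (simp_all add: klein_coeff_def field_simps)

lemma klein_coeff_theta:
  assumes "i \<le> 3"
  shows "klein_coeff i (theta b) = (if i = 0 then 1 else - 1) * (klein_coeff i b :: 'a)"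
proof -
  have "qtrace b / 2 = 2 * klein_coeff 0 b"
    using two four_neq_zero by (simp add: qtrace_def klein_coeff_def sum_4 divide_simps)
  then show ?thesis
    using assms by (simp add: theta_def)
qed

text \<open>
  Distinct nontrivial characters multiply to the third one and each of them squares to \<open>a\<^sub>0\<close>.
\<close>

lemma klein_coeff_mult:
  fixes b c :: "'a ^ 4"
  shows "klein_coeff 0 (b * c) = klein_coeff 0 b * klein_coeff 0 c + klein_coeff 1 b * klein_coeff 1 c
      + klein_coeff 2 b * klein_coeff 2 c + klein_coeff 3 b * klein_coeff 3 c" (is "_ = ?c0")
    and "klein_coeff 1 (b * c) = klein_coeff 0 b * klein_coeff 1 c + klein_coeff 1 b * klein_coeff 0 c
      + klein_coeff 2 b * klein_coeff 3 c + klein_coeff 3 b * klein_coeff 2 c" (is "_ = ?c1")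
    and "klein_coeff 2 (b * c) = klein_coeff 0 b * klein_coeff 2 c + klein_coeff 2 b * klein_coeff 0 c
      + klein_coeff 3 b * klein_coeff 1 c + klein_coeff 1 b * klein_coeff 3 c" (is "_ = ?c2")
    and "klein_coeff 3 (b * c) = klein_coeff 0 b * klein_coeff 3 c + klein_coeff 3 b * klein_coeff 0 c
      + klein_coeff 1 b * klein_coeff 2 c + klein_coeff 2 b * klein_coeff 1 c" (is "_ = ?c3")
proof -
  have prod: "of_klein_coeffs p * of_klein_coeffs q = of_klein_coeffs
      (\<lambda>i. if i = 0 then p 0 * q 0 + p 1 * q 1 + p 2 * q 2 + p 3 * q 3
           else if i = 1 then p 0 * q 1 + p 1 * q 0 + p 2 * q 3 + p 3 * q 2
           else if i = 2 then p 0 * q 2 + p 2 * q 0 + p 3 * q 1 + p 1 * q 3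
           else p 0 * q 3 + p 3 * q 0 + p 1 * q 2 + p 2 * q 1)" for p q :: "nat \<Rightarrow> 'a"
    by (simp add: vec_eq_iff forall_4 of_klein_coeffs_def algebra_simps)
  have "b * c = of_klein_coeffs
      (\<lambda>i. if i = 0 then ?c0 else if i = 1 then ?c1 else if i = 2 then ?c2 else ?c3)"
    using prod[of "\<lambda>i. klein_coeff i b" "\<lambda>i. klein_coeff i c"]
    by (simp only: of_klein_coeffs_klein_coeff)
  then show "klein_coeff 0 (b * c) = ?c0" "klein_coeff 1 (b * c) = ?c1"
    "klein_coeff 2 (b * c) = ?c2" "klein_coeff 3 (b * c) = ?c3"
    by (simp_all add: klein_coeff_of_klein_coeffs)
qed

lemma coord_of_coords [simp]:
  assumes "i \<le> 3"
  shows "coord \<epsilon> i (of_coords c) = (c \<epsilon> i :: 'a)"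
  using two four_neq_zero by (cases \<epsilon>) (simp_all add: coord_def of_coords_def klein_coeff_of_klein_coeffs assms field_simps)

lemma coord_ext:
  assumes "\<And>\<epsilon> i. i \<le> 3 \<Longrightarrow> coord \<epsilon> i v = (coord \<epsilon> i w :: 'a)"
  shows "v = w"
proof -
  have "2 * klein_coeff i (fst v) = 2 * klein_coeff i (fst w) \<and>
        2 * klein_coeff i (snd v) = 2 * klein_coeff i (snd w)" if "i \<le> 3" for i
    using assms[OF that, of True] assms[OF that, of False]
    by (simp add: coord_def) algebra
  then show ?thesis
    using two by (intro prod_eqI klein_coeff_ext) simp_all
qed

lemma coord_linear [simp]:
  "coord \<epsilon> i (v + w) = coord \<epsilon> i v + (coord \<epsilon> i w :: 'a)"
  "coord \<epsilon> i (qc_scale r v) = r * (coord \<epsilon> i v :: 'a)"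
  "coord \<epsilon> i 0 = (0 :: 'a)"
  by (simp_all add: coord_def qc_scale_def algebra_simps)

lemma coord_bar [simp]:
  assumes "i \<le> 3"
  shows "coord \<epsilon> i (qc_bar v) = (coord (if i = 0 then \<not> \<epsilon> else \<epsilon>) i v :: 'a)"
  by (cases v) (use assms in \<open>simp add: coord_def klein_coeff_theta\<close>)

lemma coord_one [simp]: "i \<le> 3 \<Longrightarrow> coord \<epsilon> i qc_one = (if i = 0 then 1 else 0 :: 'a)"
  by (simp add: coord_def qc_one_def)

lemma coord_s [simp]:
  "i \<le> 3 \<Longrightarrow> coord \<epsilon> i qc_s = (if i = 0 then if \<epsilon> then 1 else - 1 else 0 :: 'a)"
  by (simp add: coord_def qc_s_def)

text \<open>
  The product of two lines \<open>a\<^sub>i\<close> and \<open>a\<^sub>j\<close> lies over \<open>a\<^sub>i a\<^sub>j\<close>, so a component over \<open>a\<^sub>0\<close> arises only for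
  \<open>i = j\<close>. There the sign \<open>-1\<close> of \<open>theta\<close> on \<open>a\<^sub>i\<close> leaves only products of opposite \<open>\<epsilon>\<close> when \<open>i > 0\<close>.
\<close>

lemma coord_mult_0:
  "coord \<epsilon> 0 (qc_mult v w) = (coord \<epsilon> 0 v * coord \<epsilon> 0 w
     + (\<Sum>i\<in>{1..3}. coord \<epsilon> i v * coord (\<not> \<epsilon>) i w) :: 'a)"
  by (cases v; cases w)
     (simp add: coord_def klein_coeff_theta klein_coeff_mult sum_1_3 algebra_simps del: One_nat_def)

text \<open>
  Over a nontrivial character the involution twists the right action of \<open>K\<close>, and the product of two
  different nontrivial characters reverses the sign. The double sum is the symmetric cross product.
\<close>

lemma coord_mult:
  assumes "i \<in> {1..3}"
  shows "coord \<epsilon> i (qc_mult v w) = (coord \<epsilon> 0 v * coord \<epsilon> i w + coord \<epsilon> i v * coord (\<not> \<epsilon>) 0 w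
     + (\<Sum>j\<in>{1..3}. \<Sum>k\<in>{1..3}. if distinct [i, j, k] then coord (\<not> \<epsilon>) j v * coord (\<not> \<epsilon>) k w else 0) :: 'a)"
  using assms unfolding mem_1_3_iff
  by (cases v; cases w; elim disjE)
     (simp_all add: coord_def klein_coeff_theta klein_coeff_mult sum_1_3 algebra_simps del: One_nat_def)

lemmas coord_simps = coord_of_coords coord_one coord_bar coord_linear

text \<open>
  Index \<open>0\<close> gives the two idempotents \<open>(1 \<plusminus> s)/2\<close>.
\<close>

definition peirce_unit :: "bool \<Rightarrow> nat \<Rightarrow> 'a quartic_cayley" where
  "peirce_unit \<epsilon> i = of_coords (\<lambda>\<delta> j. if \<delta> = \<epsilon> \<and> j = i then 1 else 0)"

lemma coord_peirce_unit:
  "j \<le> 3 \<Longrightarrow> coord \<delta> j (peirce_unit \<epsilon> i) = (if \<delta> = \<epsilon> \<and> j = i then 1 else 0 :: 'a)"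
  by (simp add: peirce_unit_def coord_simps)

section \<open>Monomial automorphisms\<close>

definition monomial_map ::
    "(bool \<Rightarrow> nat \<Rightarrow> 'a) \<Rightarrow> bool \<Rightarrow> (nat \<Rightarrow> nat) \<Rightarrow> 'a quartic_cayley \<Rightarrow> 'a quartic_cayley" where
  "monomial_map w g \<tau> v = of_coords (\<lambda>\<epsilon> i. w \<epsilon> i * coord (\<epsilon> \<noteq> g) (inv' \<tau> i) v)"

lemma coord_monomial_map:
  assumes "i \<le> 3"
  shows "coord \<epsilon> i (monomial_map w g \<tau> v) = (w \<epsilon> i * coord (\<epsilon> \<noteq> g) (inv' \<tau> i) v :: 'a)"
  by (simp add: monomial_map_def coord_simps assms)

lemma monomial_map_comp:
  assumes "\<tau> permutes {1..3}" "\<tau>' permutes {1..3}"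
  shows "monomial_map w g \<tau> \<circ> monomial_map w' g' \<tau>' =
    monomial_map (\<lambda>\<epsilon> i. w \<epsilon> i * w' (\<epsilon> \<noteq> g) (inv' \<tau> i) :: 'a) (g \<noteq> g') (\<tau> \<circ> \<tau>')"
proof (rule ext, rule coord_ext)
  fix v :: "'a quartic_cayley" and \<epsilon> i assume i: "i \<le> (3::nat)"
  have "inv' (\<tau> \<circ> \<tau>') = inv' \<tau>' \<circ> inv' \<tau>"
    using assms by (intro o_inv_distrib permutes_bij)
  moreover have "inv' \<tau> i \<le> 3"
    using permutes_1_3(3) permutes_inv assms(1) i by blast
  moreover have "((\<epsilon> \<noteq> g) \<noteq> g') = (\<epsilon> \<noteq> (g \<noteq> g'))"
    by blast
  ultimately show "coord \<epsilon> i ((monomial_map w g \<tau> \<circ> monomial_map w' g' \<tau>') v) =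
      coord \<epsilon> i (monomial_map (\<lambda>\<epsilon> i. w \<epsilon> i * w' (\<epsilon> \<noteq> g) (inv' \<tau> i)) (g \<noteq> g') (\<tau> \<circ> \<tau>') v)"
    using i by (simp add: coord_monomial_map mult.assoc)
qed

text \<open>
  The scalings compatible with the product: the pairing of the components \<open>(\<epsilon>, i)\<close> and \<open>(\<not> \<epsilon>, i)\<close>
  requires inverse factors, and the cross product requires the factors over the three characters to
  have product one. The value \<open>1\<close> at index \<open>0\<close> keeps the two idempotents unscaled.
\<close>

definition weights :: "(bool \<Rightarrow> nat \<Rightarrow> 'a) \<Rightarrow> bool" where
  "weights w \<longleftrightarrow> (\<forall>\<epsilon>. w \<epsilon> 0 = 1) \<and> (\<forall>i\<in>{1..3}. w True i * w False i = 1) \<and>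
     (\<forall>\<epsilon>. w \<epsilon> 1 * w \<epsilon> 2 * w \<epsilon> 3 = 1)"

lemma weightsD:
  assumes "weights w"
  shows "w \<epsilon> 0 = 1"
    and "i \<le> 3 \<Longrightarrow> w \<epsilon> i * w (\<not> \<epsilon>) i = 1"
    and "i \<le> 3 \<Longrightarrow> w \<epsilon> i \<noteq> 0"
    and "\<lbrakk>i \<in> {1..3}; j \<in> {1..3}; k \<in> {1..3}; distinct [i, j, k]\<rbrakk> \<Longrightarrow> w \<epsilon> j * w \<epsilon> k = w (\<not> \<epsilon>) i"
proof -
  show 0: "w \<epsilon> 0 = 1" for \<epsilon>
    using assms by (simp add: weights_def)
  show 1: "w \<epsilon> i * w (\<not> \<epsilon>) i = 1" if "i \<le> 3" for \<epsilon> i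
    using assms 0 that by (cases "i = 0"; cases \<epsilon>) (simp_all add: weights_def mult.commute)
  show "w \<epsilon> i \<noteq> 0" if "i \<le> 3"
    using 1[OF that, of \<epsilon>] by auto
  assume ijk: "i \<in> {1..3}" "j \<in> {1..3}" "k \<in> {1..3}" "distinct [i, j, k]"
  have "w \<epsilon> 1 * w \<epsilon> 2 * w \<epsilon> 3 = 1"
    using assms by (simp add: weights_def)
  then have "w \<epsilon> i * (w \<epsilon> j * w \<epsilon> k) = 1"
    using ijk unfolding mem_1_3_iff by (elim disjE) (simp_all add: ac_simps)
  moreover have "w \<epsilon> i * w (\<not> \<epsilon>) i = 1"
    using ijk 1 by simp
  ultimately show "w \<epsilon> j * w \<epsilon> k = w (\<not> \<epsilon>) i"
    by algebra
qed

text \<open>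
  Reindexing by the permutation turns the pairing and the cross product of the permuted vectors into
  those of the original ones. The scaling is absorbed because opposite factors over one character
  cancel, and factors over two different characters multiply to the opposite factor over the third.
\<close>

lemma monomial_map_mult:
  assumes w: "weights w" and \<tau>: "\<tau> permutes {1..3}"
  shows "monomial_map w g \<tau> (qc_mult x y) =
    (qc_mult (monomial_map w g \<tau> x) (monomial_map w g \<tau> y) :: 'a quartic_cayley)"
proof (rule coord_ext)
  define p where "p = inv' \<tau>"
  have p: "p permutes {1..3}"
    unfolding p_def using \<tau> by (rule permutes_inv)
  have p0: "p 0 = 0" and p_in: "\<And>i. i \<in> {1..3} \<Longrightarrow> p i \<in> {1..3}"
    using permutes_1_3[OF p] by blast+
  have p_inj: "p i = p j \<longleftrightarrow> i = j" for i j
    using permutes_inj[OF p] by (simp add: inj_eq)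
  fix \<epsilon> i assume i3: "i \<le> (3::nat)"
  have co: "coord \<epsilon> i (monomial_map w g \<tau> v) = w \<epsilon> i * coord (\<epsilon> \<noteq> g) (p i) v" if "i \<le> 3" for \<epsilon> i v
    using that by (simp add: coord_monomial_map p_def)
  note w0 = weightsD(1)[OF w] and w1 = weightsD(2)[OF w] and w2 = weightsD(4)[OF w]
  have neg: "((\<not> \<epsilon>) \<noteq> g) = (\<not> (\<epsilon> \<noteq> g))" by blast
  let ?\<delta> = "\<epsilon> \<noteq> g"
  show "coord \<epsilon> i (monomial_map w g \<tau> (qc_mult x y)) =
      coord \<epsilon> i (qc_mult (monomial_map w g \<tau> x) (monomial_map w g \<tau> y))"
  proof (cases "i = 0")
    case True
    \<comment> \<open>The pairing is invariant under the permutation and under mutually inverse scalings.\<close>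
    have "(\<Sum>j\<in>{1..3}. coord ?\<delta> j x * coord (\<not> ?\<delta>) j y)
        = (\<Sum>j\<in>{1..3}. coord ?\<delta> (p j) x * coord (\<not> ?\<delta>) (p j) y)"
      by (subst sum.permute[OF p]) (simp add: o_def)
    also have "\<dots> = (\<Sum>j\<in>{1..3}. (w \<epsilon> j * w (\<not> \<epsilon>) j) * (coord ?\<delta> (p j) x * coord (\<not> ?\<delta>) (p j) y))"
      by (intro sum.cong refl) (simp add: w1)
    also have "\<dots> = (\<Sum>j\<in>{1..3}. coord \<epsilon> j (monomial_map w g \<tau> x) * coord (\<not> \<epsilon>) j (monomial_map w g \<tau> y))"
      by (intro sum.cong refl) (simp add: co neg mult_ac)
    finally show ?thesis
      using True by (simp add: co p0 w0 coord_mult_0)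
  next
    case False
    then have i: "i \<in> {1..3}" using i3 by simp
    \<comment> \<open>The cross product is equivariant under the permutation, and scaling both arguments by
      \<open>w (\<not> \<epsilon>)\<close> scales its entry \<open>i\<close> by \<open>w \<epsilon> i\<close>.\<close>
    define F where "F = (\<lambda>j k. if distinct [p i, j, k] then coord (\<not> ?\<delta>) j x * coord (\<not> ?\<delta>) k y else 0)"
    have "w \<epsilon> i * (\<Sum>j\<in>{1..3}. \<Sum>k\<in>{1..3}. F j k) = w \<epsilon> i * (\<Sum>j\<in>{1..3}. \<Sum>k\<in>{1..3}. F (p j) (p k))"
      by (subst sum.permute[OF p], subst sum.permute[OF p]) (simp add: o_def)
    also have "\<dots> = (\<Sum>j\<in>{1..3}. \<Sum>k\<in>{1..3}. w \<epsilon> i * F (p j) (p k))"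
      by (simp add: sum_distrib_left)
    also have "\<dots> = (\<Sum>j\<in>{1..3}. \<Sum>k\<in>{1..3}. if distinct [i, j, k]
         then coord (\<not> \<epsilon>) j (monomial_map w g \<tau> x) * coord (\<not> \<epsilon>) k (monomial_map w g \<tau> y) else 0)"
    proof (intro sum.cong refl)
      fix j k :: nat assume jk: "j \<in> {1..3}" "k \<in> {1..3}"
      show "w \<epsilon> i * F (p j) (p k) = (if distinct [i, j, k]
         then coord (\<not> \<epsilon>) j (monomial_map w g \<tau> x) * coord (\<not> \<epsilon>) k (monomial_map w g \<tau> y) else 0)"
      proof (cases "distinct [i, j, k]")
        case True
        have "w (\<not> \<epsilon>) j * w (\<not> \<epsilon>) k = w \<epsilon> i"
          using w2[OF i jk True, of "\<not> \<epsilon>"] by simp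
        then show ?thesis
          using True jk by (simp add: F_def co neg p_inj mult_ac)
      next
        case False
        then show ?thesis by (auto simp: F_def p_inj)
      qed
    qed
    finally have "w \<epsilon> i * (\<Sum>j\<in>{1..3}. \<Sum>k\<in>{1..3}. F j k) = \<dots>" .
    then show ?thesis
      by (simp only: F_def co[OF i3] coord_mult[OF i] coord_mult[OF p_in[OF i]]
            co[of 0] p0 w0 neg mult_1 algebra_simps)
  qed
qed

lemma monomial_map_bar:
  assumes "weights w" and "\<tau> permutes {1..3}"
  shows "monomial_map w g \<tau> (qc_bar x) = (qc_bar (monomial_map w g \<tau> x) :: 'a quartic_cayley)"
proof (rule coord_ext)
  fix \<epsilon> i assume i: "i \<le> (3::nat)"
  have p: "inv' \<tau> permutes {1..3}" using assms(2) by (rule permutes_inv)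
  show "coord \<epsilon> i (monomial_map w g \<tau> (qc_bar x)) = coord \<epsilon> i (qc_bar (monomial_map w g \<tau> x))"
    using permutes_1_3(3,4)[OF p, of i] i weightsD(1)[OF assms(1)]
    by (auto simp: coord_monomial_map coord_simps)
qed

text \<open>
  By the composition formula, the inverse is again a monomial map.
\<close>

lemma monomial_map_bij:
  assumes w: "weights w" and \<tau>: "\<tau> permutes {1..3}"
  shows "bij (monomial_map w g \<tau> :: 'a quartic_cayley \<Rightarrow> _)"
proof (rule o_bij)
  define w' where "w' = (\<lambda>\<epsilon> i. inverse (w (\<epsilon> \<noteq> g) (\<tau> i)))"
  have \<tau>i: "inv' \<tau> permutes {1..3}" and [simp]: "inv' (inv' \<tau>) = \<tau>"
    using \<tau> by (auto intro: permutes_inv simp: permutes_inv_inv)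
  have id: "monomial_map u False id = (id :: 'a quartic_cayley \<Rightarrow> _)" if "\<And>\<epsilon> i. i \<le> 3 \<Longrightarrow> u \<epsilon> i = 1" for u
    by (rule ext, rule coord_ext) (simp add: coord_monomial_map that)
  have g: "((\<epsilon> = (\<not> g)) = (\<not> g)) = \<epsilon>" for \<epsilon> by blast
  show "monomial_map w' g (inv' \<tau>) \<circ> monomial_map w g \<tau> = id"
    unfolding monomial_map_comp[OF \<tau>i \<tau>] permutes_inv_o(2)[OF \<tau>]
    using permutes_1_3(3)[OF \<tau>] weightsD(3)[OF w] by (simp add: w'_def id)
  show "monomial_map w g \<tau> \<circ> monomial_map w' g (inv' \<tau>) = id"
    unfolding monomial_map_comp[OF \<tau> \<tau>i] permutes_inv_o(1)[OF \<tau>]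
    using weightsD(3)[OF w] by (simp add: w'_def g permutes_inverses[OF \<tau>] id)
qed

lemma monomial_map_linear:
  "Vector_Spaces.linear qc_scale qc_scale (monomial_map w g \<tau> :: 'a quartic_cayley \<Rightarrow> _)"
  unfolding Vector_Spaces.linear_iff
  by (intro conjI allI vector_space_qc_scale coord_ext)
    (simp_all add: coord_monomial_map coord_simps algebra_simps)

lemma monomial_map_Aut:
  assumes "weights w" and "\<tau> permutes {1..3}"
  shows "(monomial_map w g \<tau> :: 'a quartic_cayley \<Rightarrow> _) \<in> carrier Aut_quartic_cayley"
  unfolding Aut_quartic_cayley_def
  using monomial_map_mult[OF assms] monomial_map_bar[OF assms] monomial_map_bij[OF assms]
    monomial_map_linear by (auto simp del: qc_mult.simps qc_bar.simps)

lemma monomial_map_cong: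
  assumes "\<And>\<epsilon> i. i \<le> 3 \<Longrightarrow> w \<epsilon> i = w' \<epsilon> i"
  shows "monomial_map w g \<tau> = (monomial_map w' g \<tau> :: 'a quartic_cayley \<Rightarrow> _)"
  by (rule ext, rule coord_ext) (simp add: coord_monomial_map assms)

text \<open>
  A monomial map sends a basis vector to a nonzero multiple of a basis vector, and this multiple and its
  position determine \<open>g\<close>, \<open>\<tau>\<close> and \<open>w\<close>.
\<close>

lemma monomial_map_inj:
  assumes w: "weights w" and \<tau>: "\<tau> permutes {1..3}" "\<tau>' permutes {1..3}"
    and eq: "monomial_map w g \<tau> = (monomial_map w' g' \<tau>' :: 'a quartic_cayley \<Rightarrow> _)"
  shows "g = g'" "\<tau> = \<tau>'" "i \<le> 3 \<Longrightarrow> w \<epsilon> i = w' \<epsilon> i"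
proof -
  have eq': "w \<delta> j * coord (\<delta> \<noteq> g) (inv' \<tau> j) v = w' \<delta> j * coord (\<delta> \<noteq> g') (inv' \<tau>' j) v" if "j \<le> 3" for \<delta> j v
    using coord_monomial_map[OF that, of \<delta> w g \<tau> v] coord_monomial_map[OF that, of \<delta> w' g' \<tau>' v]
    unfolding eq by (rule trans[OF sym])
  have p: "inv' \<tau> j \<le> 3" "inv' \<tau>' j \<le> 3" if "j \<le> 3" for j
    using that permutes_1_3(3) permutes_inv \<tau> by blast+
  have key: "g = g' \<and> inv' \<tau> j = inv' \<tau>' j \<and> w \<delta> j = w' \<delta> j" if j: "j \<le> 3" for j \<delta>
    using eq'[OF j, of \<delta> "peirce_unit (\<delta> \<noteq> g) (inv' \<tau> j)"] weightsD(3)[OF w j, of \<delta>]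
    by (auto simp: coord_peirce_unit p j split: if_splits)
  then show "g = g'" "i \<le> 3 \<Longrightarrow> w \<epsilon> i = w' \<epsilon> i"
    by blast+
  have "inv' \<tau> j = inv' \<tau>' j" for j
    using key[of j] permutes_not_in[OF permutes_inv[OF \<tau>(1)], of j]
      permutes_not_in[OF permutes_inv[OF \<tau>(2)], of j] by (cases "j \<le> 3") auto
  then have "inv' \<tau> = inv' \<tau>'" by blast
  then show "\<tau> = \<tau>'"
    using \<tau> by (metis permutes_inv_inv)
qed

section \<open>Every automorphism is monomial\<close>

lemma linear_eq_on_peirce_units:
  fixes f h :: "'a quartic_cayley \<Rightarrow> 'a quartic_cayley"
  assumes f: "Vector_Spaces.linear qc_scale qc_scale f" and h: "Vector_Spaces.linear qc_scale qc_scale h"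
    and eq: "\<And>\<epsilon> i. i \<le> 3 \<Longrightarrow> f (peirce_unit \<epsilon> i) = h (peirce_unit \<epsilon> i)"
  shows "f = h"
proof
  interpret f: Vector_Spaces.linear qc_scale qc_scale f by (rule f)
  interpret h: Vector_Spaces.linear qc_scale qc_scale h by (rule h)
  fix v :: "'a quartic_cayley"
  define t where "t \<epsilon> i = qc_scale (coord \<epsilon> i v) (peirce_unit \<epsilon> i)" for \<epsilon> i
  have v: "v = (t True 0 + t True 1 + t True 2 + t True 3) + (t False 0 + t False 1 + t False 2 + t False 3)"
  proof (rule coord_ext)
    fix \<epsilon> i assume "i \<le> (3::nat)"
    then show "coord \<epsilon> i v = coord \<epsilon> i ((t True 0 + t True 1 + t True 2 + t True 3)
        + (t False 0 + t False 1 + t False 2 + t False 3))"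
      by (cases rule: le_3_cases; cases \<epsilon>)
        (simp_all add: t_def coord_simps coord_peirce_unit)
  qed
  have "f (t \<epsilon> i) = h (t \<epsilon> i)" if "i \<le> 3" for \<epsilon> i
    using eq[OF that] by (simp add: t_def f.scale h.scale)
  then show "f v = h v"
    by (subst (1 2) v) (simp add: f.add h.add del: One_nat_def)
qed

lemma peirce_unit_mult:
  fixes \<epsilon> :: bool
  defines "u \<equiv> peirce_unit :: bool \<Rightarrow> nat \<Rightarrow> 'a quartic_cayley"
  shows "qc_mult (u \<epsilon> 0) (u \<epsilon> 0) = u \<epsilon> 0"
    and "i \<in> {1..3} \<Longrightarrow> qc_mult (u \<epsilon> 0) (u \<epsilon> i) = u \<epsilon> i"
    and "i \<in> {1..3} \<Longrightarrow> qc_mult (u \<epsilon> i) (u \<epsilon> 0) = 0"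
    and "i \<in> {1..3} \<Longrightarrow> j \<in> {1..3} \<Longrightarrow> qc_mult (u \<epsilon> i) (u (\<not> \<epsilon>) j) = (if i = j then u \<epsilon> 0 else 0)"
    and "i \<in> {1..3} \<Longrightarrow> qc_mult (u \<epsilon> i) (u \<epsilon> i) = 0"
    and "\<lbrakk>i \<in> {1..3}; j \<in> {1..3}; k \<in> {1..3}; distinct [i, j, k]\<rbrakk> \<Longrightarrow> qc_mult (u \<epsilon> i) (u \<epsilon> j) = u (\<not> \<epsilon>) k"
proof -
  have mult_eqI: "qc_mult x y = z" if "\<And>\<delta>. coord \<delta> 0 (qc_mult x y) = coord \<delta> 0 z"
    "\<And>\<delta> l. l \<in> {1..3} \<Longrightarrow> coord \<delta> l (qc_mult x y) = coord \<delta> l z" for x y z :: "'a quartic_cayley"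
  proof (rule coord_ext)
    fix \<delta> l assume "l \<le> (3::nat)"
    then show "coord \<delta> l (qc_mult x y) = coord \<delta> l z"
      using that by (cases "l = 0") auto
  qed
  note calc = coord_mult_0 coord_mult sum_1_3 coord_peirce_unit coord_simps
  show "qc_mult (u \<epsilon> 0) (u \<epsilon> 0) = u \<epsilon> 0"
    by (rule mult_eqI) (simp_all add: u_def calc del: One_nat_def)
  show "i \<in> {1..3} \<Longrightarrow> qc_mult (u \<epsilon> 0) (u \<epsilon> i) = u \<epsilon> i"
    by (rule mult_eqI) (auto simp: u_def calc simp del: One_nat_def)
  show "i \<in> {1..3} \<Longrightarrow> qc_mult (u \<epsilon> i) (u \<epsilon> 0) = 0"
    by (rule mult_eqI) (auto simp: u_def calc simp del: One_nat_def)
  show "i \<in> {1..3} \<Longrightarrow> j \<in> {1..3} \<Longrightarrow> qc_mult (u \<epsilon> i) (u (\<not> \<epsilon>) j) = (if i = j then u \<epsilon> 0 else 0)"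
    by (rule mult_eqI; unfold mem_1_3_iff; elim disjE) (auto simp: u_def calc simp del: One_nat_def)
  show "i \<in> {1..3} \<Longrightarrow> qc_mult (u \<epsilon> i) (u \<epsilon> i) = 0"
    by (rule mult_eqI; unfold mem_1_3_iff; elim disjE) (auto simp: u_def calc simp del: One_nat_def)
  show "\<lbrakk>i \<in> {1..3}; j \<in> {1..3}; k \<in> {1..3}; distinct [i, j, k]\<rbrakk> \<Longrightarrow> qc_mult (u \<epsilon> i) (u \<epsilon> j) = u (\<not> \<epsilon>) k"
    by (rule mult_eqI; unfold mem_1_3_iff; elim disjE) (auto simp: u_def calc simp del: One_nat_def)
qed

lemma qc_mult_qc_one:
  fixes v :: "'a quartic_cayley"
  shows "qc_mult qc_one v = v" and "qc_mult v qc_one = v"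
proof -
  have "coord \<delta> l (qc_mult qc_one v) = coord \<delta> l v \<and> coord \<delta> l (qc_mult v qc_one) = coord \<delta> l v"
    if "l \<le> 3" for \<delta> l
    using that
    by (cases "l = 0") (simp_all add: coord_mult_0 coord_mult coord_simps sum_1_3 del: One_nat_def)
  then show "qc_mult qc_one v = v" "qc_mult v qc_one = v"
    by (auto intro: coord_ext)
qed

text \<open>
  The image \<open>e\<close> of \<open>(1 + s)/2\<close> satisfies \<open>e + qc_bar e = 1\<close>. The involution fixes the components over
  the nontrivial characters, so these components of \<open>e\<close> are equal to their negatives and vanish.
  Therefore \<open>e\<close> lies in \<open>K\<close>, and being idempotent it has coordinates \<open>0\<close> and \<open>1\<close> in some order.
\<close>

lemma automorphism_peirce_idempotents:
  fixes f :: "'a quartic_cayley \<Rightarrow> 'a quartic_cayley"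
  assumes f: "f \<in> carrier Aut_quartic_cayley"
  obtains g where "\<And>\<epsilon>. f (peirce_unit \<epsilon> 0) = peirce_unit (\<epsilon> \<noteq> g) 0"
proof -
  have bij: "bij f" and lin: "Vector_Spaces.linear qc_scale qc_scale f"
    and mult: "\<And>x y. f (qc_mult x y) = qc_mult (f x) (f y)" and bar: "\<And>x. f (qc_bar x) = qc_bar (f x)"
    using f by (auto simp: Aut_quartic_cayley_def)
  interpret f: Vector_Spaces.linear qc_scale qc_scale f by (rule lin)
  define u where "u = (peirce_unit :: bool \<Rightarrow> nat \<Rightarrow> 'a quartic_cayley)"
  note coord_u = coord_peirce_unit[folded u_def]
  note calc = coord_mult_0 coord_mult coord_u coord_simps
  have f_one: "f qc_one = qc_one"
  proof -
    obtain z where "f z = qc_one"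
      using bij by (metis bij_pointE)
    then show ?thesis
      using mult[of qc_one z] by (simp add: qc_mult_qc_one)
  qed
  have bar_u: "qc_bar (u \<epsilon> 0) = u (\<not> \<epsilon>) 0" for \<epsilon>
    by (rule coord_ext) (auto simp: calc)
  have sum_u: "u True 0 + u False 0 = qc_one"
    by (rule coord_ext) (auto simp: calc)

  define e where "e = f (u True 0)"
  have fF: "f (u False 0) = qc_bar e"
    unfolding e_def bar[symmetric] bar_u by simp
  have e_bar: "e + qc_bar e = qc_one"
    using arg_cong[OF sum_u, of f] by (simp add: f.add f_one fF flip: e_def)
  have *: "coord \<epsilon> l e + coord (if l = 0 then \<not> \<epsilon> else \<epsilon>) l e = (if l = 0 then 1 else 0)"
    if l: "l \<le> 3" for \<epsilon> l
    using arg_cong[OF e_bar, of "coord \<epsilon> l"]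
    by (simp only: coord_one[OF l] coord_bar[OF l] coord_linear)
  have e0: "coord \<epsilon> l e = 0" if "l \<in> {1..3}" for \<epsilon> l
  proof -
    have "2 * coord \<epsilon> l e = 0"
      using *[of l \<epsilon>] that by simp
    then show ?thesis using two by simp
  qed
  have e_idem: "qc_mult e e = e"
    unfolding e_def mult[symmetric] peirce_unit_mult(1)[folded u_def] ..
  have "coord True 0 e * coord True 0 e = coord True 0 e"
    using arg_cong[OF e_idem, of "coord True 0"] by (simp add: calc e0)
  then have T: "coord True 0 e = 0 \<or> coord True 0 e = 1"
    by simp
  define h where "h \<longleftrightarrow> coord True 0 e = 0"
  have "e = u (True \<noteq> h) 0"
  proof (rule coord_ext)
    fix \<epsilon> l assume l: "l \<le> (3::nat)"
    show "coord \<epsilon> l e = coord \<epsilon> l (u (True \<noteq> h) 0)"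
      using T *[of 0 \<epsilon>] e0[of l \<epsilon>] l
      by (cases "l = 0"; cases \<epsilon>) (auto simp: coord_u h_def)
  qed
  then have "f (u \<epsilon> 0) = u (\<epsilon> \<noteq> h) 0" for \<epsilon>
    using fF by (cases \<epsilon>) (simp_all add: bar_u flip: e_def)
  then show ?thesis using that unfolding u_def by blast
qed

text \<open>
  Let \<open>V \<epsilon> i\<close> be the image of a basis vector over a nontrivial character. The products with the two
  idempotents place it in a single half \<open>\<epsilon> \<noteq> g\<close>. Its square is zero, so exactly one of its three
  coordinates \<open>c \<epsilon> i\<close> survives, at a position \<open>t i\<close>. The pairing of the two halves shows that
  \<open>t\<close> does not depend on \<open>\<epsilon>\<close> and is injective.
\<close>

lemma automorphism_is_monomial:
  fixes f :: "'a quartic_cayley \<Rightarrow> 'a quartic_cayley"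
  assumes f: "f \<in> carrier Aut_quartic_cayley"
  obtains w g \<tau> where "weights w" "\<tau> permutes {1..3}" "f = monomial_map w g \<tau>"
proof -
  have lin: "Vector_Spaces.linear qc_scale qc_scale f"
    and mult: "\<And>x y. f (qc_mult x y) = qc_mult (f x) (f y)"
    using f by (auto simp: Aut_quartic_cayley_def)
  interpret f: Vector_Spaces.linear qc_scale qc_scale f by (rule lin)
  define u where "u = (peirce_unit :: bool \<Rightarrow> nat \<Rightarrow> 'a quartic_cayley)"
  note coord_u = coord_peirce_unit[folded u_def]
  note u_mult = peirce_unit_mult[folded u_def]
  note calc = coord_mult_0 coord_mult coord_u coord_simps

  obtain g where g: "\<And>\<epsilon>. f (u \<epsilon> 0) = u (\<epsilon> \<noteq> g) 0"
    using automorphism_peirce_idempotents[OF f] unfolding u_def by blast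

  have unit_left: "coord (\<not> \<delta>) j (qc_mult (u \<delta> 0) v) = 0" if "j \<in> {1..3}" for \<delta> j v
    using that unfolding mem_1_3_iff
    by (elim disjE) (simp_all add: coord_mult sum_1_3 coord_u del: One_nat_def)

  define V where "V = (\<lambda>\<epsilon> i. f (u \<epsilon> i))"
  \<comment> \<open>A basis vector over a nontrivial character is fixed by its own idempotent on the left and
    killed by it on the right. Its image inherits this with respect to the idempotent of sign
    \<open>\<epsilon> \<noteq> g\<close>; the sign \<open>\<epsilon> = g\<close> is the opposite one.\<close>
  have V0: "coord \<eta> 0 (V \<epsilon> i) = 0" and V1: "coord (\<epsilon> = g) j (V \<epsilon> i) = 0"
    if i: "i \<in> {1..3}" and j: "j \<in> {1..3}" for \<eta> \<epsilon> i j
  proof -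
    have L: "qc_mult (u (\<epsilon> \<noteq> g) 0) (V \<epsilon> i) = V \<epsilon> i" and R: "qc_mult (V \<epsilon> i) (u (\<epsilon> \<noteq> g) 0) = 0"
      unfolding V_def g[symmetric] mult[symmetric] u_mult(2,3)[OF i] by (simp_all add: f.zero)
    show "coord \<eta> 0 (V \<epsilon> i) = 0"
      using arg_cong[OF L, of "coord \<eta> 0"] arg_cong[OF R, of "coord \<eta> 0"]
      by (cases "\<eta> = (\<epsilon> \<noteq> g)") (auto simp: calc)
    show "coord (\<epsilon> = g) j (V \<epsilon> i) = 0"
      using unit_left[OF j, of "\<epsilon> \<noteq> g" "V \<epsilon> i"] unfolding L by simp
  qed

  define c where "c = (\<lambda>\<epsilon> i j. coord (\<epsilon> \<noteq> g) j (V \<epsilon> i))"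
  have neg: "((\<not> \<epsilon>) \<noteq> g) = (\<not> (\<epsilon> \<noteq> g))" for \<epsilon> by blast
  have dual: "(\<Sum>k\<in>{1..3}. c \<epsilon> i k * c (\<not> \<epsilon>) j k) = (if i = j then 1 else 0)"
    if ij: "i \<in> {1..3}" "j \<in> {1..3}" for \<epsilon> i j
  proof -
    have "qc_mult (V \<epsilon> i) (V (\<not> \<epsilon>) j) = (if i = j then u (\<epsilon> \<noteq> g) 0 else 0)"
      unfolding V_def mult[symmetric] u_mult(4)[OF ij] by (simp add: g f.zero)
    from arg_cong[OF this, of "coord (\<epsilon> \<noteq> g) 0"] show ?thesis
      using ij by (simp add: coord_mult_0 V0 c_def neg coord_u coord_simps split: if_splits)
  qed
  have cross: "(\<Sum>m\<in>{1..3}. \<Sum>n\<in>{1..3}. if distinct [l, m, n] then c \<epsilon> i m * c \<epsilon> j n else 0)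
      = coord (\<epsilon> = g) l (qc_mult (V \<epsilon> i) (V \<epsilon> j))"
    if "i \<in> {1..3}" "j \<in> {1..3}" "l \<in> {1..3}" for \<epsilon> i j l
  proof -
    have "(\<not> (\<epsilon> = g)) = (\<epsilon> \<noteq> g)" by blast
    then show ?thesis
      using that by (simp add: coord_mult V0 c_def cong: if_cong)
  qed
  have square: "c \<epsilon> i m * c \<epsilon> i n = 0"
    if i: "i \<in> {1..3}" and mn: "m \<in> {1..3}" "n \<in> {1..3}" "m \<noteq> n" for \<epsilon> i m n
  proof -
    have sq: "qc_mult (V \<epsilon> i) (V \<epsilon> i) = 0"
      unfolding V_def mult[symmetric] u_mult(5)[OF i] by (simp add: f.zero)
    \<comment> \<open>the third index, since \<open>1 + 2 + 3 = 6\<close>\<close>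
    define l where "l = 6 - m - n"
    have l: "l \<in> {1..3}" "l \<noteq> m" "l \<noteq> n"
      using mn unfolding l_def mem_1_3_iff by auto
    have "(\<Sum>m\<in>{1..3}. \<Sum>n\<in>{1..3}. if distinct [l, m, n] then c \<epsilon> i m * c \<epsilon> i n else 0) = 0"
      unfolding cross[OF i i l(1)] sq by (simp add: coord_simps)
    then have "2 * (c \<epsilon> i m * c \<epsilon> i n) = 0"
      using sum_distinct_1_3[OF l(1) mn(1,2), of "c \<epsilon> i" "c \<epsilon> i"] l mn by (simp add: mult.commute)
    then show ?thesis using two by simp
  qed

  \<comment> \<open>The pairing of \<open>V True i\<close> with \<open>V False i\<close> is \<open>1\<close>, so both are nonzero at a common position.\<close>
  have "\<exists>t\<in>{1..3}. c True i t * c False i t \<noteq> 0" if "i \<in> {1..3}" for i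
    using dual[OF that that, of True] by (metis (no_types, lifting) sum.neutral zero_neq_one)
  then obtain t where t: "\<And>i. i \<in> {1..3} \<Longrightarrow> t i \<in> {1..3}"
    and ct: "\<And>i. i \<in> {1..3} \<Longrightarrow> c True i (t i) * c False i (t i) \<noteq> 0"
    by metis
  have c_ne: "c \<epsilon> i (t i) \<noteq> 0" if "i \<in> {1..3}" for \<epsilon> i
    using ct[OF that] by (cases \<epsilon>) auto
  have c0: "c \<epsilon> i k = 0" if "i \<in> {1..3}" "k \<in> {1..3}" "k \<noteq> t i" for \<epsilon> i k
    using square[OF that(1) t[OF that(1)] that(2)] that c_ne[of i \<epsilon>] by auto
  have dual_t: "c \<epsilon> i (t i) * c (\<not> \<epsilon>) j (t i) = (if i = j then 1 else 0)"
    if ij: "i \<in> {1..3}" "j \<in> {1..3}" for \<epsilon> i j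
  proof -
    have "(\<Sum>k\<in>{1..3}. c \<epsilon> i k * c (\<not> \<epsilon>) j k) = (\<Sum>k\<in>{t i}. c \<epsilon> i k * c (\<not> \<epsilon>) j k)"
      using t ij by (intro sum.mono_neutral_right) (auto simp: c0)
    then show ?thesis using dual[OF ij] by simp
  qed

  define \<tau> where "\<tau> i = (if i \<in> {1..3} then t i else i)" for i
  have \<tau>: "\<tau> permutes {1..3}"
  proof (rule inj_imp_permutes)
    show "inj_on \<tau> {1..3}"
    proof (rule inj_onI, rule ccontr)
      fix i j assume ij: "i \<in> {1..3}" "j \<in> {1..3}" "\<tau> i = \<tau> j" "i \<noteq> j"
      then have "c True i (t i) * c False j (t j) = 0"
        using dual_t[of i j True] by (simp add: \<tau>_def)
      then show False using c_ne ij by simp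
    qed
    show "\<tau> i \<in> {1..3}" if "i \<in> {1..3}" for i
      using t[OF that] that by (simp add: \<tau>_def)
  qed (auto simp: \<tau>_def)
  define p where "p = inv' \<tau>"
  have p: "p permutes {1..3}" unfolding p_def using \<tau> by (rule permutes_inv)
  have p_in: "p j \<in> {1..3}" if "j \<in> {1..3}" for j
    using permutes_1_3(2)[OF p that] .
  have tp: "t (p j) = j" if "j \<in> {1..3}" for j
    using permutes_inverses(1)[OF \<tau>, of j] p_in[OF that] by (simp add: \<tau>_def p_def)
  have p_eq: "p j = i \<longleftrightarrow> j = t i" if "i \<in> {1..3}" "j \<in> {1..3}" for i j
    using permutes_inv_eq[OF \<tau>, of j i] that by (auto simp: \<tau>_def p_def)

  \<comment> \<open>Weights are indexed by the target: the line over \<open>j\<close> receives the line over \<open>p j\<close>.\<close>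
  define w where "w \<delta> j = (if j = 0 then 1 else c (\<delta> \<noteq> g) (p j) j)" for \<delta> j
  have "weights w"
    unfolding weights_def
  proof (intro conjI allI ballI)
    show "w \<epsilon> 0 = 1" for \<epsilon> by (simp add: w_def)
    show inv: "w True i * w False i = 1" if i: "i \<in> {1..3}" for i
      using dual_t[OF p_in[OF i] p_in[OF i], of "True \<noteq> g"] i by (simp add: w_def tp)
    show "w \<epsilon> 1 * w \<epsilon> 2 * w \<epsilon> 3 = 1" for \<epsilon>
    proof -
      define \<delta> where "\<delta> \<longleftrightarrow> (\<epsilon> \<noteq> g)"
      have in3: "1 \<in> {1..3::nat}" "2 \<in> {1..3::nat}" "3 \<in> {1..3::nat}" by simp_all
      have dp: "distinct [p 1, p 2, p 3]"
        using permutes_inj[OF p] by (simp add: inj_eq)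
      \<comment> \<open>The basis vectors over \<open>p 1\<close> and \<open>p 2\<close> multiply to the one over \<open>p 3\<close> of the opposite sign;
        entry \<open>3\<close> of the image of this equation relates the three weights.\<close>
      have VV: "qc_mult (V \<delta> (p 1)) (V \<delta> (p 2)) = V (\<not> \<delta>) (p 3)"
        unfolding V_def mult[symmetric]
        using u_mult(6)[OF p_in[OF in3(1)] p_in[OF in3(2)] p_in[OF in3(3)] dp] by simp
      have d: "distinct [3, 1, 2 :: nat]" by simp
      have "c \<delta> (p 1) 1 * c \<delta> (p 2) 2 + c \<delta> (p 1) 2 * c \<delta> (p 2) 1
          = coord (\<delta> = g) 3 (V (\<not> \<delta>) (p 3))"
        unfolding VV[symmetric] cross[OF p_in[OF in3(1)] p_in[OF in3(2)] in3(3), symmetric]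
        by (rule sum_distinct_1_3[OF in3(3,1,2) d, symmetric])
      also have "\<dots> = c (\<not> \<delta>) (p 3) 3"
        by (simp add: c_def)
      finally have "c \<delta> (p 1) 1 * c \<delta> (p 2) 2 + c \<delta> (p 1) 2 * c \<delta> (p 2) 1 = c (\<not> \<delta>) (p 3) 3" .
      moreover have "c \<delta> (p 1) 2 = 0"
        using p_in[OF in3(1)] tp[OF in3(1)] by (intro c0) auto
      ultimately have "w \<epsilon> 1 * w \<epsilon> 2 = w (\<not> \<epsilon>) 3"
        by (simp add: w_def \<delta>_def neg)
      then show ?thesis
        using inv[of 3] by (cases \<epsilon>) (simp_all add: mult.commute)
    qed
  qed
  moreover have "f = monomial_map w g \<tau>"
  proof (rule linear_eq_on_peirce_units[OF lin monomial_map_linear])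
    fix \<epsilon> i assume i: "i \<le> (3::nat)"
    show "f (peirce_unit \<epsilon> i) = monomial_map w g \<tau> (peirce_unit \<epsilon> i)"
      unfolding u_def[symmetric]
    proof (rule coord_ext)
      fix \<eta> j assume j: "j \<le> (3::nat)"
      have rhs: "coord \<eta> j (monomial_map w g \<tau> (u \<epsilon> i)) = (if (\<eta> \<noteq> g) = \<epsilon> \<and> p j = i then w \<eta> j else 0)"
        using permutes_1_3(3)[OF p j] by (simp add: coord_monomial_map[OF j] coord_u flip: p_def)
      have p00: "p j = 0 \<longleftrightarrow> j = 0" using permutes_1_3(4)[OF p] .
      show "coord \<eta> j (f (u \<epsilon> i)) = coord \<eta> j (monomial_map w g \<tau> (u \<epsilon> i))"
      proof (cases "i = 0")
        case True
        then show ?thesis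
          unfolding rhs using j by (auto simp: g coord_u p00 w_def)
      next
        case False
        then have i: "i \<in> {1..3}" using i by simp
        show ?thesis
        proof (cases "j = 0")
          case True
          then show ?thesis
            unfolding rhs using V0[OF i i] False p00 by (simp add: V_def)
        next
          case False
          then have j: "j \<in> {1..3}" using j by simp
          have lhs: "coord \<eta> j (f (u \<epsilon> i)) = (if (\<eta> \<noteq> g) = \<epsilon> then c \<epsilon> i j else 0)"
            using V1[OF i j, of \<epsilon>] by (cases \<epsilon>; cases g; cases \<eta>) (simp_all add: c_def V_def)
          show ?thesis
          proof (cases "p j = i")
            case True
            then show ?thesis
              unfolding lhs rhs using False by (simp add: w_def)
          next
            case False
            then have "c \<epsilon> i j = 0"
              using c0[OF i j] p_eq[OF i j] by blast
            then show ?thesis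
              unfolding lhs rhs using False by simp
          qed
        qed
      qed
    qed
  qed
  ultimately show ?thesis
    using \<tau> that by blast
qed

section \<open>The circle group, triples and the isomorphism\<close>

lemma K_mult: "mult K_monoid = (qc_mult :: 'a quartic_cayley \<Rightarrow> _)"
  and K_one: "one K_monoid = (qc_one :: 'a quartic_cayley)"
  by (simp_all add: K_monoid_def)

lemma carrier_K_iff:
  "r \<in> carrier K_monoid \<longleftrightarrow> (\<forall>\<epsilon>. \<forall>i\<in>{1..3}. coord \<epsilon> i r = (0 :: 'a))"
proof
  assume "r \<in> carrier K_monoid"
  then show "\<forall>\<epsilon>. \<forall>i\<in>{1..3}. coord \<epsilon> i r = 0"
    by (auto simp: K_monoid_def coord_simps coord_s)
next
  assume r: "\<forall>\<epsilon>. \<forall>i\<in>{1..3}. coord \<epsilon> i r = 0"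
  have "r = qc_scale ((coord True 0 r + coord False 0 r) / 2) qc_one
          + qc_scale ((coord True 0 r - coord False 0 r) / 2) qc_s"
  proof (rule coord_ext)
    fix \<epsilon> i assume "i \<le> (3::nat)"
    then show "coord \<epsilon> i r = coord \<epsilon> i (qc_scale ((coord True 0 r + coord False 0 r) / 2) qc_one
          + qc_scale ((coord True 0 r - coord False 0 r) / 2) qc_s)"
      using r two four_neq_zero by (cases "i = 0"; cases \<epsilon>)
        (simp_all add: coord_simps coord_s field_simps)
  qed
  then show "r \<in> carrier K_monoid"
    by (auto simp: K_monoid_def)
qed

text \<open>
  Left multiplication by an element of \<open>K\<close> acts on the two lines of \<open>K\<close> by the coordinates of that element.
\<close>

lemma coord_mult_K:
  assumes "r \<in> carrier K_monoid"
  shows "coord \<epsilon> 0 (qc_mult r v) = coord \<epsilon> 0 r * (coord \<epsilon> 0 v :: 'a)"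
  using assms by (simp add: coord_mult_0 carrier_K_iff)

lemma K_ext:
  assumes "r \<in> carrier K_monoid" "t \<in> carrier K_monoid" "\<And>\<epsilon>. coord \<epsilon> 0 r = (coord \<epsilon> 0 t :: 'a)"
  shows "r = t"
proof (rule coord_ext)
  fix \<epsilon> i assume "i \<le> (3::nat)"
  then show "coord \<epsilon> i r = coord \<epsilon> i t"
    using assms by (cases "i = 0") (simp_all add: carrier_K_iff)
qed

lemma coord_C2_act: "coord \<epsilon> i (C2_act g r) = (coord (\<epsilon> \<noteq> (g \<noteq> 0)) i r :: 'a)"
  by (cases \<epsilon>; cases "g = 0") (simp_all add: C2_act_def K_aut_def coord_def klein_coeff_linear)

lemma K_closed:
  fixes r t :: "'a quartic_cayley"
  assumes "r \<in> carrier K_monoid"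
  shows "t \<in> carrier K_monoid \<Longrightarrow> qc_mult r t \<in> carrier K_monoid"
    and "qc_bar r \<in> carrier K_monoid"
    and "C2_act g r \<in> carrier K_monoid"
  using assms
  by (auto simp: carrier_K_iff coord_mult coord_bar coord_C2_act intro!: sum.neutral)

text \<open>
  The involution exchanges the two coordinates on \<open>K\<close>, so \<open>r\<close> times its conjugate has both coordinates
  equal to the product of the coordinates of \<open>r\<close>. That product being one, the conjugate is the inverse.
\<close>

lemma carrier_S1_iff:
  "r \<in> carrier S1 \<longleftrightarrow> r \<in> carrier K_monoid \<and> coord True 0 r * coord False 0 r = (1 :: 'a)"
proof
  assume "r \<in> carrier S1"
  then have r: "r \<in> carrier K_monoid" and "qc_mult r (qc_bar r) = qc_one"
    by (auto simp: S1_def Units_def)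
  then show "r \<in> carrier K_monoid \<and> coord True 0 r * coord False 0 r = 1"
    using coord_mult_K[OF r, of True "qc_bar r"] by (simp add: coord_simps)
next
  assume r: "r \<in> carrier K_monoid \<and> coord True 0 r * coord False 0 r = 1"
  have K: "qc_one \<in> carrier (K_monoid :: 'a quartic_cayley monoid)" "qc_bar r \<in> carrier K_monoid"
    using r K_closed(2)[of r] by (simp_all add: carrier_K_iff coord_simps)
  have "coord \<epsilon> 0 r * coord (\<not> \<epsilon>) 0 r = 1" for \<epsilon>
    using r by (cases \<epsilon>) (simp_all add: mult.commute)
  then have "qc_mult r (qc_bar r) = qc_one" "qc_mult (qc_bar r) r = qc_one"
    using r K by (auto intro!: K_ext K_closed simp: coord_mult_K coord_simps mult.commute)
  then show "r \<in> carrier S1"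
    using r K unfolding S1_def Units_def by (auto simp: K_mult K_one intro!: bexI[of _ "qc_bar r"])
qed

lemma S1_coord_inverse:
  assumes "r \<in> carrier S1"
  shows "coord \<epsilon> 0 r * coord (\<not> \<epsilon>) 0 r = (1 :: 'a)"
  using assms by (cases \<epsilon>) (simp_all add: carrier_S1_iff mult.commute)

lemma S1_closed:
  fixes r t :: "'a quartic_cayley"
  assumes r: "r \<in> carrier S1"
  shows "t \<in> carrier S1 \<Longrightarrow> qc_mult r t \<in> carrier S1"
    and "qc_bar r \<in> carrier S1"
    and "C2_act g r \<in> carrier S1"
proof -
  show "qc_mult r t \<in> carrier S1" if "t \<in> carrier S1"
    using r that S1_coord_inverse[OF r, of True] S1_coord_inverse[OF that, of True]
    by (simp add: carrier_S1_iff K_closed coord_mult_K) algebra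
  show "qc_bar r \<in> carrier S1"
    using r by (auto simp: carrier_S1_iff coord_simps mult.commute intro: K_closed)
  show "C2_act g r \<in> carrier S1"
    using r by (cases "g = 0") (auto simp: carrier_S1_iff coord_C2_act mult.commute intro: K_closed)
qed

lemma triple_entry_S1:
  fixes r1 r2 :: "'a quartic_cayley"
  assumes "r1 \<in> carrier S1" "r2 \<in> carrier S1"
  shows "triple_entry r1 r2 i \<in> carrier S1"
  using assms by (simp add: triple_entry_def S1_closed)

text \<open>
  The two coordinates of the entry \<open>r\<^sub>i\<close> of a triple are the factors on the two lines over \<open>a\<^sub>i\<close>.
\<close>

definition triple_weights :: "'a quartic_cayley \<Rightarrow> 'a quartic_cayley \<Rightarrow> bool \<Rightarrow> nat \<Rightarrow> 'a" where
  "triple_weights r1 r2 \<epsilon> i = (if i = 0 then 1 else coord \<epsilon> 0 (triple_entry r1 r2 i))"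

lemma triple_weights_simps:
  fixes r1 r2 :: "'a quartic_cayley"
  assumes "r1 \<in> carrier S1" "r2 \<in> carrier S1"
  shows "triple_weights r1 r2 \<epsilon> 0 = 1" "triple_weights r1 r2 \<epsilon> 1 = coord \<epsilon> 0 r1"
    "triple_weights r1 r2 \<epsilon> 2 = coord \<epsilon> 0 r2"
    "triple_weights r1 r2 \<epsilon> 3 = coord (\<not> \<epsilon>) 0 r1 * coord (\<not> \<epsilon>) 0 r2"
  using assms by (simp_all add: triple_weights_def triple_entry_def coord_simps coord_mult_K carrier_S1_iff)

lemma weights_triple_weights:
  fixes r1 r2 :: "'a quartic_cayley"
  assumes "r1 \<in> carrier S1" "r2 \<in> carrier S1"
  shows "weights (triple_weights r1 r2)"
proof -
  have "triple_weights r1 r2 True i * triple_weights r1 r2 False i = 1" if "i \<in> {1..3}" for i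
    using that S1_coord_inverse[OF triple_entry_S1[OF assms], of True i]
    by (simp add: triple_weights_def)
  moreover have "triple_weights r1 r2 \<epsilon> 1 * triple_weights r1 r2 \<epsilon> 2 * triple_weights r1 r2 \<epsilon> 3 = 1" for \<epsilon>
    unfolding triple_weights_simps[OF assms]
    using S1_coord_inverse[OF assms(1), of \<epsilon>] S1_coord_inverse[OF assms(2), of \<epsilon>] by algebra
  ultimately show ?thesis
    by (simp add: weights_def triple_weights_simps(1)[OF assms])
qed

text \<open>
  The first two entries of the triple can be prescribed freely, and both sides then agree at index \<open>3\<close>
  because the product of the three factors is one.
\<close>

lemma weights_eq_triple_weights:
  fixes w :: "bool \<Rightarrow> nat \<Rightarrow> 'a"
  assumes w: "weights w"
  obtains r1 r2 where "r1 \<in> carrier S1" "r2 \<in> carrier S1"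
    "\<And>\<epsilon> i. i \<le> 3 \<Longrightarrow> triple_weights r1 r2 \<epsilon> i = w \<epsilon> i"
proof -
  define r where "r j = of_coords (\<lambda>\<epsilon> i. if i = 0 then w \<epsilon> j else 0)" for j
  have co: "coord \<epsilon> 0 (r j) = w \<epsilon> j" for \<epsilon> j
    by (simp add: r_def coord_simps)
  have S: "r j \<in> carrier S1" if "j \<le> 3" for j
    using weightsD(2)[OF w that, of True] unfolding carrier_S1_iff carrier_K_iff co
    by (auto simp: r_def coord_simps)
  have S12: "r 1 \<in> carrier S1" "r 2 \<in> carrier S1"
    by (rule S; simp)+
  have "triple_weights (r 1) (r 2) \<epsilon> i = w \<epsilon> i" if "i \<le> 3" for \<epsilon> i
    using that
  proof (cases rule: le_3_cases)
    case 4
    then show ?thesis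
      using weightsD(4)[OF w, of 3 1 2 "\<not> \<epsilon>"] triple_weights_simps(4)[OF S12] by (simp add: co)
  qed (simp_all add: triple_weights_simps[OF S12] co weightsD(1)[OF w] del: One_nat_def)
  then show ?thesis
    using that S12 by blast
qed

lemma triple_weights_inj:
  fixes r1 r2 t1 t2 :: "'a quartic_cayley"
  assumes "r1 \<in> carrier S1" "r2 \<in> carrier S1" "t1 \<in> carrier S1" "t2 \<in> carrier S1"
    and "\<And>\<epsilon> i. i \<le> 3 \<Longrightarrow> triple_weights r1 r2 \<epsilon> i = triple_weights t1 t2 \<epsilon> i"
  shows "r1 = t1 \<and> r2 = t2"
proof (intro conjI K_ext)
  show "coord \<epsilon> 0 r1 = coord \<epsilon> 0 t1" "coord \<epsilon> 0 r2 = coord \<epsilon> 0 t2" for \<epsilon>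
    using assms(5)[of 1 \<epsilon>] assms(5)[of 2 \<epsilon>]
    unfolding triple_weights_simps[OF assms(1,2)] triple_weights_simps[OF assms(3,4)] by simp_all
qed (use assms(1-4) in \<open>simp_all add: carrier_S1_iff\<close>)

lemma carrier_S1S1_C2_S3:
  "(((r1, r2), g), \<tau>) \<in> carrier S1S1_C2_S3 \<longleftrightarrow>
    r1 \<in> carrier S1 \<and> r2 \<in> carrier S1 \<and> g \<in> {0, 1} \<and> \<tau> permutes {1..3}"
proof -
  have "{0..<2} = {0, 1::int}" by auto
  then show ?thesis
    by (auto simp: S1S1_C2_S3_def S1S1_C2_def semidirect_product_def carrier_integer_mod_group
        sym_group_def DirProd_def)
qed

lemma mult_S1S1_C2_S3:
  "(((r1, r2), g), \<tau>) \<otimes>\<^bsub>S1S1_C2_S3\<^esub> (((s1, s2), h), \<upsilon>) =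
    (((qc_mult r1 (C2_act g (triple_entry s1 s2 (inv' \<tau> 1))),
       qc_mult r2 (C2_act g (triple_entry s1 s2 (inv' \<tau> 2)))), (g + h) mod 2), \<tau> \<circ> \<upsilon>)"
  by (simp add: S1S1_C2_S3_def S1S1_C2_def semidirect_product_def sym_group_def DirProd_def
      S1_def units_of_def K_monoid_def)

lemma S1S1_C2_S3_cases:
  obtains r1 r2 g \<tau> where "x = (((r1, r2), g), \<tau>)"
  using that[of "fst (fst (fst x))" "snd (fst (fst x))" "snd (fst x)" "snd x"] by simp

text \<open>
  The automorphism \<open>k a\<^sub>i \<mapsto> r\<^sub>\<tau>\<^sub>(\<^sub>i\<^sub>) g(k) a\<^sub>\<tau>\<^sub>(\<^sub>i\<^sub>)\<close> for \<open>k\<close> in \<open>K\<close>.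
\<close>

definition monomial_of ::
    "(('a quartic_cayley \<times> 'a quartic_cayley) \<times> int) \<times> (nat \<Rightarrow> nat) \<Rightarrow> 'a quartic_cayley \<Rightarrow> 'a quartic_cayley" where
  "monomial_of = (\<lambda>(((r1, r2), g), \<tau>). monomial_map (triple_weights r1 r2) (g \<noteq> 0) \<tau>)"

text \<open>
  By \<open>monomial_map_comp\<close> it suffices to compare weights. Moving the permutation of \<open>x\<close> past the scaling
  of \<open>y\<close> permutes the triple of \<open>y\<close>, and moving the exchange of \<open>x\<close> past it conjugates the triple; these are
  the two actions in the semidirect products. The comparison at index \<open>3\<close> follows from those at \<open>1\<close> and
  \<open>2\<close>, because a third weight is determined by the other two.
\<close>

lemma monomial_of_hom:
  fixes x y :: "(('a quartic_cayley \<times> 'a quartic_cayley) \<times> int) \<times> (nat \<Rightarrow> nat)"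
  assumes "x \<in> carrier S1S1_C2_S3" "y \<in> carrier S1S1_C2_S3"
  shows "x \<otimes>\<^bsub>S1S1_C2_S3\<^esub> y \<in> carrier S1S1_C2_S3"
    and "monomial_of (x \<otimes>\<^bsub>S1S1_C2_S3\<^esub> y) = monomial_of x \<circ> monomial_of y"
proof -
  obtain r1 r2 g \<tau> where x: "x = (((r1, r2), g), \<tau>)"
    by (cases x rule: S1S1_C2_S3_cases)
  obtain s1 s2 h \<upsilon> where y: "y = (((s1, s2), h), \<upsilon>)"
    by (cases y rule: S1S1_C2_S3_cases)
  have r: "r1 \<in> carrier S1" "r2 \<in> carrier S1" and g: "g \<in> {0, 1}" and \<tau>: "\<tau> permutes {1..3}"
    and s: "s1 \<in> carrier S1" "s2 \<in> carrier S1" and h: "h \<in> {0, 1}" and \<upsilon>: "\<upsilon> permutes {1..3}"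
    using assms by (auto simp: x y carrier_S1S1_C2_S3)
  define p where "p = inv' \<tau>"
  have p: "p permutes {1..3}" unfolding p_def using \<tau> by (rule permutes_inv)
  have p_in: "p i \<in> {1..3}" if "i \<in> {1..3}" for i
    using permutes_1_3(2)[OF p that] .
  define q1 where "q1 = qc_mult r1 (C2_act g (triple_entry s1 s2 (p 1)))"
  define q2 where "q2 = qc_mult r2 (C2_act g (triple_entry s1 s2 (p 2)))"
  have xy: "x \<otimes>\<^bsub>S1S1_C2_S3\<^esub> y = (((q1, q2), (g + h) mod 2), \<tau> \<circ> \<upsilon>)"
    by (simp add: x y mult_S1S1_C2_S3 q1_def q2_def p_def)
  have q: "q1 \<in> carrier S1" "q2 \<in> carrier S1"
    unfolding q1_def q2_def
    by (intro S1_closed(1) S1_closed(3) triple_entry_S1 r s)+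
  then show "x \<otimes>\<^bsub>S1S1_C2_S3\<^esub> y \<in> carrier S1S1_C2_S3"
    unfolding xy carrier_S1S1_C2_S3 using permutes_compose[OF \<upsilon> \<tau>] by auto
  note w_q = weights_triple_weights[OF q] and w_r = weights_triple_weights[OF r]
    and w_s = weights_triple_weights[OF s]
  let ?w = "\<lambda>\<epsilon> i. triple_weights r1 r2 \<epsilon> i * triple_weights s1 s2 (\<epsilon> \<noteq> (g \<noteq> 0)) (p i)"
  have p12: "p 1 \<noteq> 0" "p 2 \<noteq> 0"
    using permutes_1_3(4)[OF p] by simp_all
  have q12: "triple_weights q1 q2 \<epsilon> 1 = ?w \<epsilon> 1" "triple_weights q1 q2 \<epsilon> 2 = ?w \<epsilon> 2" for \<epsilon>
    unfolding triple_weights_simps[OF q] triple_weights_simps[OF r]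
    using r p12 by (simp_all add: q1_def q2_def coord_mult_K carrier_S1_iff coord_C2_act triple_weights_def)
  have q3: "triple_weights q1 q2 \<epsilon> 3 = ?w \<epsilon> 3" for \<epsilon>
  proof -
    have in3: "1 \<in> {1..3::nat}" "2 \<in> {1..3::nat}" "3 \<in> {1..3::nat}" by simp_all
    have dp: "distinct [p 3, p 1, p 2]"
      using permutes_inj[OF p] by (simp add: inj_eq)
    have neg: "((\<not> \<epsilon>) \<noteq> (g \<noteq> 0)) = (\<not> (\<epsilon> \<noteq> (g \<noteq> 0)))" by blast
    have "triple_weights q1 q2 \<epsilon> 3 = ?w (\<not> \<epsilon>) 1 * ?w (\<not> \<epsilon>) 2"
      using weightsD(4)[OF w_q in3(3,1,2), of "\<not> \<epsilon>"] by (simp add: q12[unfolded One_nat_def])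
    also have "\<dots> = (triple_weights r1 r2 (\<not> \<epsilon>) 1 * triple_weights r1 r2 (\<not> \<epsilon>) 2) *
        (triple_weights s1 s2 (\<not> (\<epsilon> \<noteq> (g \<noteq> 0))) (p 1) * triple_weights s1 s2 (\<not> (\<epsilon> \<noteq> (g \<noteq> 0))) (p 2))"
      unfolding neg by (simp add: mult_ac)
    also have "\<dots> = ?w \<epsilon> 3"
      using weightsD(4)[OF w_r in3(3,1,2), of "\<not> \<epsilon>"]
        weightsD(4)[OF w_s p_in[OF in3(3)] p_in[OF in3(1)] p_in[OF in3(2)] dp, of "\<not> (\<epsilon> \<noteq> (g \<noteq> 0))"]
      by simp
    finally show ?thesis .
  qed
  have w: "triple_weights q1 q2 \<epsilon> i = ?w \<epsilon> i" if "i \<le> 3" for \<epsilon> i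
    using that
  proof (cases rule: le_3_cases)
    case 1
    then show ?thesis
      using weightsD(1)[OF w_q] weightsD(1)[OF w_r] weightsD(1)[OF w_s] permutes_1_3(1)[OF p] by simp
  qed (use q12 q3 in simp_all)
  have gh: "((g + h) mod 2 \<noteq> 0) = ((g \<noteq> 0) \<noteq> (h \<noteq> 0))"
    using g h by auto
  have "monomial_of (x \<otimes>\<^bsub>S1S1_C2_S3\<^esub> y) = monomial_map (triple_weights q1 q2) ((g \<noteq> 0) \<noteq> (h \<noteq> 0)) (\<tau> \<circ> \<upsilon>)"
    unfolding xy monomial_of_def prod.case gh ..
  also have "\<dots> = monomial_map ?w ((g \<noteq> 0) \<noteq> (h \<noteq> 0)) (\<tau> \<circ> \<upsilon>)"
    by (rule monomial_map_cong[OF w])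
  also have "\<dots> = monomial_of x \<circ> monomial_of y"
    unfolding x y monomial_of_def prod.case monomial_map_comp[OF \<tau> \<upsilon>] p_def ..
  finally show "monomial_of (x \<otimes>\<^bsub>S1S1_C2_S3\<^esub> y) = monomial_of x \<circ> monomial_of y" .
qed

lemma monomial_of_bij_betw:
  "bij_betw monomial_of (carrier S1S1_C2_S3) (carrier (Aut_quartic_cayley :: ('a quartic_cayley \<Rightarrow> _) monoid))"
  unfolding bij_betw_def
proof (intro conjI inj_onI equalityI subsetI)
  fix x y :: "(('a quartic_cayley \<times> 'a quartic_cayley) \<times> int) \<times> (nat \<Rightarrow> nat)"
  assume xy: "x \<in> carrier S1S1_C2_S3" "y \<in> carrier S1S1_C2_S3" and eq: "monomial_of x = monomial_of y"
  obtain r1 r2 g \<tau> where x: "x = (((r1, r2), g), \<tau>)"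
    by (cases x rule: S1S1_C2_S3_cases)
  obtain s1 s2 h \<upsilon> where y: "y = (((s1, s2), h), \<upsilon>)"
    by (cases y rule: S1S1_C2_S3_cases)
  have r: "r1 \<in> carrier S1" "r2 \<in> carrier S1" and g: "g \<in> {0, 1}" and \<tau>: "\<tau> permutes {1..3}"
    and s: "s1 \<in> carrier S1" "s2 \<in> carrier S1" and h: "h \<in> {0, 1}" and \<upsilon>: "\<upsilon> permutes {1..3}"
    using xy by (auto simp: x y carrier_S1S1_C2_S3)
  note inj = monomial_map_inj[OF weights_triple_weights[OF r] \<tau> \<upsilon>
      eq[unfolded x y monomial_of_def prod.case]]
  have "g = h" using inj(1) g h by auto
  moreover have "r1 = s1 \<and> r2 = s2"
    by (rule triple_weights_inj[OF r s inj(3)])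
  ultimately show "x = y"
    using inj(2) by (simp add: x y)
next
  fix f :: "'a quartic_cayley \<Rightarrow> 'a quartic_cayley"
  assume "f \<in> monomial_of ` carrier S1S1_C2_S3"
  then obtain r1 r2 g \<tau> where "f = monomial_of (((r1, r2), g), \<tau>)" "(((r1, r2), g), \<tau>) \<in> carrier S1S1_C2_S3"
    by auto
  then show "f \<in> carrier Aut_quartic_cayley"
    by (simp add: monomial_of_def carrier_S1S1_C2_S3 monomial_map_Aut weights_triple_weights
        del: One_nat_def)
next
  fix f :: "'a quartic_cayley \<Rightarrow> 'a quartic_cayley"
  assume "f \<in> carrier Aut_quartic_cayley"
  then obtain w g \<tau> where w: "weights w" and \<tau>: "\<tau> permutes {1..3}" and f: "f = monomial_map w g \<tau>"
    using automorphism_is_monomial by blast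
  obtain r1 r2 where r: "r1 \<in> carrier S1" "r2 \<in> carrier S1"
    and eq: "\<And>\<epsilon> i. i \<le> 3 \<Longrightarrow> triple_weights r1 r2 \<epsilon> i = w \<epsilon> i"
    using weights_eq_triple_weights[OF w] by blast
  have "f = monomial_of (((r1, r2), if g then 1 else 0), \<tau>)"
    unfolding f monomial_of_def prod.case using monomial_map_cong[OF eq] by simp
  moreover have "(((r1, r2), if g then 1 else 0), \<tau>) \<in> carrier S1S1_C2_S3"
    using r \<tau> by (simp add: carrier_S1S1_C2_S3 del: One_nat_def)
  ultimately show "f \<in> monomial_of ` carrier S1S1_C2_S3"
    by blast
qed

text \<open>
  The inverse of \<open>monomial_of\<close> is used, so that multiplicativity of \<open>monomial_of\<close> and closure of its
  domain suffice.
\<close>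

lemma Aut_quartic_cayley_iso: "(Aut_quartic_cayley :: ('a quartic_cayley \<Rightarrow> 'a quartic_cayley) monoid) \<cong>
    (S1S1_C2_S3 :: ((('a quartic_cayley \<times> 'a quartic_cayley) \<times> int) \<times> (nat \<Rightarrow> nat)) monoid)"
proof (rule is_isoI)
  let ?h = "inv_into (carrier S1S1_C2_S3)
    (monomial_of :: _ \<Rightarrow> 'a quartic_cayley \<Rightarrow> 'a quartic_cayley)"
  note bij = monomial_of_bij_betw
  have h_in: "?h f \<in> carrier S1S1_C2_S3" and h_eq: "monomial_of (?h f) = f"
    if "f \<in> carrier Aut_quartic_cayley" for f :: "'a quartic_cayley \<Rightarrow> 'a quartic_cayley"
    using bij_betwE[OF bij_betw_inv_into[OF bij]] bij_betw_inv_into_right[OF bij] that by blast+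
  have "?h (f \<circ> k) = ?h f \<otimes>\<^bsub>S1S1_C2_S3\<^esub> ?h k"
    if "f \<in> carrier Aut_quartic_cayley" "k \<in> carrier Aut_quartic_cayley"
    for f k :: "'a quartic_cayley \<Rightarrow> 'a quartic_cayley"
    using monomial_of_hom[OF h_in[OF that(1)] h_in[OF that(2)]]
      bij_betw_inv_into_left[OF bij] that by (metis h_eq)
  moreover have "mult (Aut_quartic_cayley :: ('a quartic_cayley \<Rightarrow> _) monoid) = (\<circ>)"
    by (simp add: Aut_quartic_cayley_def)
  ultimately show "?h \<in> iso Aut_quartic_cayley S1S1_C2_S3"
    unfolding iso_def hom_def using bij_betw_inv_into[OF bij] h_in by auto
qed

end

theorem theorem3p6:
  assumes "CHAR('a::alg_closed_field) \<notin> {2, 3, 5}"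
  shows "(Aut_quartic_cayley :: ('a quartic_cayley \<Rightarrow> 'a quartic_cayley) monoid) \<cong>
         (S1S1_C2_S3 :: ((('a quartic_cayley \<times> 'a quartic_cayley) \<times> int) \<times> (nat \<Rightarrow> nat)) monoid)"
proof (rule Aut_quartic_cayley_iso)
  show "(2::'a) \<noteq> 0"
  proof
    assume "(2::'a) = 0"
    then have "CHAR('a) dvd 2"
      by (metis of_nat_eq_0_iff_char_dvd of_nat_numeral)
    moreover have "CHAR('a) \<noteq> 1"
      by simp
    ultimately have "CHAR('a) = 2"
      using prime_nat_iff two_is_prime_nat by blast
    then show False using assms by simp
  qed
qed

end
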